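(* Let $(X,d)$ be a nonempty metric space. The following statements are equivalent: (i) $X$ is compact. (ii) For every sequence $\{u_n\}$ in $F_{USC}(X)$ and every $u\in F_{USC}(X)$: $H_{\rm end}(u_n,u)\to0$ as $n\to\infty$ if and only if $\lim_{n\to\infty}^{(\Gamma)}u_n=u$. (iii) For every sequence $\{u_n\}$ in $F_{USCG}(X)$ and every $u\in F_{USCG}(X)$: $H_{\rm end}(u_n,u)\to0$ as $n\to\infty$ if and only if $\lim_{n\to\infty}^{(\Gamma)}u_n=u$. (iv) For every sequence $\{u_n\}$ in $F_{USCB}(X)$ and every $u\in F_{USCB}(X)$: $H_{\rm end}(u_n,u)\to0$ as $n\to\infty$ if and only if $\lim_{n\to\infty}^{(\Gamma)}u_n=u$.
   Context: A fuzzy set in $X$ is a function $u:X\to[0,1]$. For $\alpha\in(0,1]$, $[u]_\alpha=\{x\in X: u(x)\ge\alpha\}$, and $[u]_0=\overline{\{x\in X: u(x)>0\}}$ (closure in $X$). $F_{USC}(X)$ is the set of fuzzy sets $u$ in $X$ such that $[u]_\alpha$ is closed (possibly empty) for all $\alpha\in[0,1]$ (the upper semicontinuous fuzzy sets); $F_{USCG}(X)$ is the set of $u\in F_{USC}(X)$ such that $[u]_\alpha$ is compact (possibly empty) for all $\alpha\in(0,1]$; $F_{USCB}(X)$ is the set of $u\in F_{USC}(X)$ such that $[u]_0$ is compact (possibly empty). $X\times[0,1]$ carries the metric $\overline d((x,\alpha),(y,\beta))=d(x,y)+|\alpha-\beta|$. The endograph of $u$ is ${\rm end}\,u=\{(x,t)\in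 X\times[0,1]: u(x)\ge t\}$; for $u\in F_{USC}(X)$ it is a nonempty closed set. For nonempty closed $A,B\subseteq X\times[0,1]$, $H(A,B)=\max\{\sup_{a\in A}\inf_{b\in B}\overline d(a,b),\ \sup_{b\in B}\inf_{a\in A}\overline d(a,b)\}$. The endograph metric on $F_{USC}(X)$ and its subsets is $H_{\rm end}(u,v)=H({\rm end}\,u,{\rm end}\,v)$. For sets $C_n$ in a metric space $Z$: $\liminf_n C_n=\{z: z=\lim_n z_n\text{ for some }z_n\in C_n\}$, and $\limsup_n C_n=\{z: z=\lim_j z_{n_j}\text{ for some subsequence }n_1<n_2<\cdots\text{ and }z_{n_j}\in C_{n_j}\}$; $\{C_n\}$ Kuratowski converges to $C$ if $C=\liminf_n C_n=\limsup_n C_n$. $\lim^{(\Gamma)}_{n\to\infty}u_n=u$ ($\Gamma$-convergence) means that $\{{\rm end}\,u_n\}$ Kuratowski converges to ${\rm end}\,u$ in $(X\times[0,1],\overline d)$. *)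

theory Defs
  imports "HOL-Analysis.Analysis"
begin

text \<open>A fuzzy set in the metric space \<open>'a\<close> is a function \<open>u :: 'a \<Rightarrow> real\<close> with values in
  \<open>[0,1]\<close>; the range condition is part of membership in \<open>F_USC\<close>.\<close>

definition cut :: "('a::metric_space \<Rightarrow> real) \<Rightarrow> real \<Rightarrow> 'a set" where
  "cut u \<alpha> = (if \<alpha> = 0 then closure {x. u x > 0} else {x. u x \<ge> \<alpha>})"

definition F_USC :: "('a::metric_space \<Rightarrow> real) set" where
  "F_USC = {u. (\<forall>x. u x \<in> {0..1}) \<and> (\<forall>\<alpha>\<in>{0..1}. closed (cut u \<alpha>))}"

definition F_USCG :: "('a::metric_space \<Rightarrow> real) set" where
  "F_USCG = {u \<in> F_USC. \<forall>\<alpha>\<in>{0<..1}. compact (cut u \<alpha>)}"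

definition F_USCB :: "('a::metric_space \<Rightarrow> real) set" where
  "F_USCB = {u \<in> F_USC. compact (cut u 0)}"

definition endograph :: "('a \<Rightarrow> real) \<Rightarrow> ('a \<times> real) set" where
  "endograph u = {(x, t). t \<in> {0..1} \<and> u x \<ge> t}"

text \<open>\<open>X \<times> [0,1]\<close> carries the sum metric, so the Euclidean product metric \<open>dist\<close> of the type
  \<open>'a \<times> real\<close> is not used.\<close>

definition dbar :: "'a::metric_space \<times> real \<Rightarrow> 'a \<times> real \<Rightarrow> real" where
  "dbar p q = dist (fst p) (fst q) + \<bar>snd p - snd q\<bar>"

lemma Metric_space_dbar: "Metric_space (UNIV \<times> {0..1}) dbar"
proof
  fix x y z :: "'a \<times> real"
  show "0 \<le> dbar x y" by (simp add: dbar_def)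
  show "dbar x y = dbar y x" by (simp add: dbar_def dist_commute)
  show "dbar x y = 0 \<longleftrightarrow> x = y"
    by (auto simp: dbar_def prod_eq_iff add_nonneg_eq_0_iff)
  show "dbar x z \<le> dbar x y + dbar y z"
    using dist_triangle[of "fst x" "fst z" "fst y"] by (simp add: dbar_def)
qed

text \<open>The real-valued suprema are only meaningful for nonempty sets with bounded excess. Endographs
  of elements of \<open>F_USC\<close> qualify: they contain \<open>X \<times> {0}\<close>, so each excess is at most \<open>1\<close>
  (\<open>endograph_hausdorff_bdd\<close> below).\<close>

definition hausdorff :: "('b \<Rightarrow> 'b \<Rightarrow> real) \<Rightarrow> 'b set \<Rightarrow> 'b set \<Rightarrow> real" where
  "hausdorff \<rho> A B = max (SUP a\<in>A. INF b\<in>B. \<rho> a b) (SUP b\<in>B. INF a\<in>A. \<rho> a b)"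

definition H_end :: "('a::metric_space \<Rightarrow> real) \<Rightarrow> ('a \<Rightarrow> real) \<Rightarrow> real" where
  "H_end u v = hausdorff dbar (endograph u) (endograph v)"

lemma endograph_hausdorff_bdd:
  assumes "v \<in> F_USC"
  shows "bdd_above ((\<lambda>a. INF b\<in>endograph v. dbar a b) ` endograph u)"
proof (rule bdd_aboveI2)
  fix a assume a: "a \<in> endograph u"
  have v: "(fst a, 0) \<in> endograph v"
    using assms by (auto simp: F_USC_def endograph_def)
  have "(INF b\<in>endograph v. dbar a b) \<le> dbar a (fst a, 0)"
    using v by (intro cINF_lower bdd_belowI2[of _ 0]) (auto simp: dbar_def)
  also have "\<dots> \<le> 1"
    using a by (auto simp: endograph_def dbar_def)
  finally show "(INF b\<in>endograph v. dbar a b) \<le> 1" .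
qed

definition kuratowski_liminf :: "'b set \<Rightarrow> ('b \<Rightarrow> 'b \<Rightarrow> real) \<Rightarrow> (nat \<Rightarrow> 'b set) \<Rightarrow> 'b set" where
  "kuratowski_liminf M \<rho> C =
     {z. \<exists>s. (\<forall>n. s n \<in> C n) \<and> limitin (Metric_space.mtopology M \<rho>) s z sequentially}"

definition kuratowski_limsup :: "'b set \<Rightarrow> ('b \<Rightarrow> 'b \<Rightarrow> real) \<Rightarrow> (nat \<Rightarrow> 'b set) \<Rightarrow> 'b set" where
  "kuratowski_limsup M \<rho> C =
     {z. \<exists>r s. strict_mono (r :: nat \<Rightarrow> nat) \<and> (\<forall>j. s j \<in> C (r j)) \<and>
           limitin (Metric_space.mtopology M \<rho>) s z sequentially}"

definition kuratowski_converges ::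
    "'b set \<Rightarrow> ('b \<Rightarrow> 'b \<Rightarrow> real) \<Rightarrow> (nat \<Rightarrow> 'b set) \<Rightarrow> 'b set \<Rightarrow> bool" where
  "kuratowski_converges M \<rho> C L \<longleftrightarrow>
     L = kuratowski_liminf M \<rho> C \<and> L = kuratowski_limsup M \<rho> C"

definition Gamma_converges :: "(nat \<Rightarrow> 'a::metric_space \<Rightarrow> real) \<Rightarrow> ('a \<Rightarrow> real) \<Rightarrow> bool" where
  "Gamma_converges u v \<longleftrightarrow>
     kuratowski_converges (UNIV \<times> {0..1}) dbar (\<lambda>n. endograph (u n)) (endograph v)"

end

theory Submission
  imports Defs
begin

text \<open>
  Convergence in the Hausdorff distance is uniform closeness of two sets in both directions, whereas
  Kuratowski convergence is pointwise closeness. The uniform notion always implies the pointwise one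
  (\<open>Gamma_converges_if_H_end_tendsto_0\<close>), since the limit is a closed set. Conversely, if
  uniform closeness fails along a subsequence, there are witnessing points that stay at a fixed
  distance from the other set. When \<open>X\<close>, and hence \<open>X \<times> [0,1]\<close>, is compact, these points
  accumulate somewhere, and the accumulation point contradicts the pointwise convergence
  (\<open>H_end_tendsto_0_if_Gamma_converges\<close>).

  If \<open>X\<close> is not compact, take a sequence \<open>x n\<close> without convergent subsequence, and let the \<open>n\<close>-th
  fuzzy set be the characteristic function of \<open>{x n}\<close>. The vertical spikes over \<open>x n\<close> never
  accumulate, so the endographs Kuratowski converge to \<open>X \<times> {0}\<close>, the endograph of \<open>0\<close>; but each
  spike has height \<open>1\<close>, so the endograph distance to \<open>0\<close> never drops below \<open>1\<close>
  (\<open>compact_if_Gamma_converges_imp_H_end_tendsto_0\<close>). These fuzzy sets have one-point support, so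
  they lie in the smallest of the three classes, while the positive result holds in the largest one.
  The inclusions between the classes then give all three equivalences at once.
\<close>

section \<open>The sum metric\<close>

lemma dbar_commute: "dbar p q = dbar q p"
  by (simp add: dbar_def dist_commute)

lemma dbar_nonneg: "0 \<le> dbar p q"
  by (simp add: dbar_def)

lemma dist_le_dbar: "dist p q \<le> dbar p q"
proof -
  have "dist p q \<le> dist (fst p) (fst q) + dist (snd p) (snd q)"
    unfolding dist_prod_def by (rule sqrt_sum_squares_le_sum) auto
  then show ?thesis by (simp add: dbar_def dist_real_def)
qed

lemma dbar_le_dist: "dbar p q \<le> 2 * dist p q"
  using dist_fst_le[of p q] dist_snd_le[of p q] by (simp add: dbar_def dist_real_def)

text \<open>By the two preceding estimates the sum metric induces the product topology, so that the limits
  in the definition of \<open>\<Gamma>\<close>-convergence are ordinary limits in the type \<open>'a \<times> real\<close>.\<close>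

lemma limitin_dbar_iff:
  fixes s :: "nat \<Rightarrow> 'a::metric_space \<times> real"
  assumes "\<And>n. s n \<in> UNIV \<times> {0..1}"
  shows "limitin (Metric_space.mtopology (UNIV \<times> {0..1}) dbar) s z sequentially
           \<longleftrightarrow> z \<in> UNIV \<times> {0..1} \<and> s \<longlonglongrightarrow> z"
proof -
  interpret M: Metric_space "UNIV \<times> {0..1}" "dbar :: 'a \<times> real \<Rightarrow> _" by (rule Metric_space_dbar)
  have "(\<forall>e>0. \<forall>\<^sub>F n in sequentially. dbar (s n) z < e) \<longleftrightarrow> s \<longlonglongrightarrow> z"
  proof
    assume *: "\<forall>e>0. \<forall>\<^sub>F n in sequentially. dbar (s n) z < e"
    show "s \<longlonglongrightarrow> z"
    proof (rule tendstoI)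
      fix e :: real assume "e > 0"
      with * have "\<forall>\<^sub>F n in sequentially. dbar (s n) z < e" by blast
      then show "\<forall>\<^sub>F n in sequentially. dist (s n) z < e"
        by eventually_elim (meson dist_le_dbar le_less_trans)
    qed
  next
    assume *: "s \<longlonglongrightarrow> z"
    show "\<forall>e>0. \<forall>\<^sub>F n in sequentially. dbar (s n) z < e"
    proof (intro allI impI)
      fix e :: real assume "e > 0"
      then have "\<forall>\<^sub>F n in sequentially. dist (s n) z < e / 2"
        by (intro tendstoD[OF *]) simp
      then show "\<forall>\<^sub>F n in sequentially. dbar (s n) z < e"
      proof eventually_elim
        case (elim n)
        then show ?case using dbar_le_dist[of "s n" z] by simp
      qed
    qed
  qed
  then show ?thesis
    using assms by (simp add: M.limitin_metric)
qed

section \<open>Endographs and their limits\<close>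

lemma endograph_subset: "endograph u \<subseteq> UNIV \<times> {0..1}"
  by (auto simp: endograph_def)

lemma floor_in_endograph: "v \<in> F_USC \<Longrightarrow> (x, 0) \<in> endograph v"
  by (auto simp: F_USC_def endograph_def)

lemma endograph_nonempty: "v \<in> F_USC \<Longrightarrow> endograph v \<noteq> {}"
  using floor_in_endograph by blast

text \<open>A limit point \<open>(x, t)\<close> above the graph, \<open>v x < t\<close>, would leave room for a level \<open>\<alpha>\<close> strictly
  between; the \<open>\<alpha>\<close>-cut is closed and eventually contains the first coordinates of the sequence, so
  it contains \<open>x\<close>.\<close>

lemma closed_endograph:
  fixes v :: "'a::metric_space \<Rightarrow> real"
  assumes v: "v \<in> F_USC"
  shows "closed (endograph v)"
  unfolding closed_sequential_limits
proof (intro allI impI, elim conjE)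
  fix s :: "nat \<Rightarrow> 'a \<times> real" and z
  assume s: "\<forall>n. s n \<in> endograph v" and lim: "s \<longlonglongrightarrow> z"
  have fst: "(\<lambda>n. fst (s n)) \<longlonglongrightarrow> fst z" and snd: "(\<lambda>n. snd (s n)) \<longlonglongrightarrow> snd z"
    using lim by (auto intro: tendsto_fst tendsto_snd)
  have le: "snd (s n) \<le> v (fst (s n))" and range: "snd (s n) \<in> {0..1}" for n
    using s[rule_format, of n] by (auto simp: endograph_def)
  have z: "snd z \<in> {0..1}"
    using closed_sequentially[OF closed_atLeastAtMost _ snd] range by blast
  have "snd z \<le> v (fst z)"
  proof (rule ccontr)
    assume "\<not> ?thesis"
    then obtain \<alpha> where \<alpha>: "v (fst z) < \<alpha>" "\<alpha> < snd z"
      by (meson dense not_le)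
    have "0 \<le> v (fst z)" using v by (auto simp: F_USC_def)
    with \<alpha> z have \<alpha>01: "\<alpha> \<in> {0..1}" "\<alpha> \<noteq> 0" by auto
    then have "closed (cut v \<alpha>)" using v by (simp add: F_USC_def)
    then have cl: "closed {x. v x \<ge> \<alpha>}" using \<alpha>01(2) by (simp add: cut_def)
    have "\<forall>\<^sub>F n in sequentially. \<alpha> < snd (s n)"
      using order_tendstoD(1)[OF snd \<alpha>(2)] .
    then have "\<forall>\<^sub>F n in sequentially. fst (s n) \<in> {x. v x \<ge> \<alpha>}"
    proof eventually_elim
      case (elim n)
      then show ?case using le[of n] by simp
    qed
    from Lim_in_closed_set[OF cl this _ fst] \<alpha>(1) show False by simp
  qed
  with z show "z \<in> endograph v"
    by (cases z) (auto simp: endograph_def)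
qed

lemma mem_liminf_endographs_iff:
  "z \<in> kuratowski_liminf (UNIV \<times> {0..1}) dbar (\<lambda>n. endograph (u n)) \<longleftrightarrow>
     z \<in> UNIV \<times> {0..1} \<and> (\<exists>s. (\<forall>n. s n \<in> endograph (u n)) \<and> s \<longlonglongrightarrow> z)"
proof -
  have "limitin (Metric_space.mtopology (UNIV \<times> {0..1}) dbar) s z sequentially
          \<longleftrightarrow> z \<in> UNIV \<times> {0..1} \<and> s \<longlonglongrightarrow> z" if "\<forall>j. s j \<in> endograph (u (r j))"
    for s and r :: "nat \<Rightarrow> nat"
    using that endograph_subset by (intro limitin_dbar_iff) blast
  from this[of _ "\<lambda>n. n"] show ?thesis
    unfolding kuratowski_liminf_def mem_Collect_eq by blast
qed

lemma mem_limsup_endographs_iff: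
  "z \<in> kuratowski_limsup (UNIV \<times> {0..1}) dbar (\<lambda>n. endograph (u n)) \<longleftrightarrow>
     z \<in> UNIV \<times> {0..1} \<and>
     (\<exists>r s. strict_mono (r :: nat \<Rightarrow> nat) \<and> (\<forall>j. s j \<in> endograph (u (r j))) \<and> s \<longlonglongrightarrow> z)"
proof -
  have "limitin (Metric_space.mtopology (UNIV \<times> {0..1}) dbar) s z sequentially
          \<longleftrightarrow> z \<in> UNIV \<times> {0..1} \<and> s \<longlonglongrightarrow> z" if "\<forall>j. s j \<in> endograph (u (r j))"
    for r :: "nat \<Rightarrow> nat" and s
    using that endograph_subset by (intro limitin_dbar_iff) blast
  then show ?thesis
    unfolding kuratowski_limsup_def mem_Collect_eq by blast
qed

text \<open>The lower limit is always contained in the upper one, so two inclusions suffice. The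
  ambient space \<open>X \<times> [0,1]\<close> is closed in \<open>'a \<times> real\<close>, so limits of points of endographs, taken
  in \<open>'a \<times> real\<close>, automatically lie in it.\<close>

lemma Gamma_converges_iff:
  "Gamma_converges u v \<longleftrightarrow>
     (\<forall>z\<in>endograph v. \<exists>s. (\<forall>n. s n \<in> endograph (u n)) \<and> s \<longlonglongrightarrow> z) \<and>
     (\<forall>r s z. strict_mono (r :: nat \<Rightarrow> nat) \<longrightarrow> (\<forall>j. s j \<in> endograph (u (r j))) \<longrightarrow> s \<longlonglongrightarrow> z
        \<longrightarrow> z \<in> endograph v)" (is "_ \<longleftrightarrow> ?lower \<and> ?upper")
proof -
  let ?li = "kuratowski_liminf (UNIV \<times> {0..1}) dbar (\<lambda>n. endograph (u n))"
  let ?ls = "kuratowski_limsup (UNIV \<times> {0..1}) dbar (\<lambda>n. endograph (u n))"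
  have "?li \<subseteq> ?ls"
  proof
    fix z assume "z \<in> ?li"
    then obtain s where "z \<in> UNIV \<times> {0..1}" "\<forall>n. s n \<in> endograph (u n)" "s \<longlonglongrightarrow> z"
      unfolding mem_liminf_endographs_iff by blast
    then show "z \<in> ?ls"
      unfolding mem_limsup_endographs_iff
      by (intro conjI exI[of _ "\<lambda>n. n"] exI[of _ s]) (auto simp: strict_mono_def)
  qed
  then have "Gamma_converges u v \<longleftrightarrow> endograph v \<subseteq> ?li \<and> ?ls \<subseteq> endograph v"
    unfolding Gamma_converges_def kuratowski_converges_def by blast
  moreover have "endograph v \<subseteq> ?li \<longleftrightarrow> ?lower"
    using endograph_subset unfolding subset_eq Ball_def mem_liminf_endographs_iff by blast
  moreover have "?ls \<subseteq> endograph v \<longleftrightarrow> ?upper"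
  proof -
    have "z \<in> UNIV \<times> {0..1}"
      if s: "\<And>j. s j \<in> endograph (u (r j))" and lim: "s \<longlonglongrightarrow> z"
      for r :: "nat \<Rightarrow> nat" and s z
    proof (rule closed_sequentially[OF _ _ lim])
      show "closed (UNIV \<times> {0..1::real} :: ('a \<times> real) set)" by (intro closed_Times) auto
      show "s j \<in> UNIV \<times> {0..1}" for j using s endograph_subset by blast
    qed
    then show ?thesis
      unfolding subset_eq Ball_def mem_limsup_endographs_iff by blast
  qed
  ultimately show ?thesis by simp
qed

section \<open>The endograph metric\<close>

lemma H_end_commute: "H_end u v = H_end v u"
  by (simp add: H_end_def hausdorff_def dbar_commute max.commute)

lemma infdist_le_H_end:
  assumes "v \<in> F_USC" and "a \<in> endograph u"
  shows "(INF b\<in>endograph v. dbar a b) \<le> H_end u v"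
proof -
  have "(INF b\<in>endograph v. dbar a b) \<le> (SUP a\<in>endograph u. INF b\<in>endograph v. dbar a b)"
    using assms endograph_hausdorff_bdd by (intro cSUP_upper)
  then show ?thesis by (simp add: H_end_def hausdorff_def)
qed

lemma close_point_if_H_end_less:
  assumes "v \<in> F_USC" and "H_end u v < e" and "a \<in> endograph u"
  obtains b where "b \<in> endograph v" and "dbar a b < e"
proof -
  have "(INF b\<in>endograph v. dbar a b) < e"
    using infdist_le_H_end[OF assms(1,3)] assms(2) by simp
  moreover have "bdd_below (dbar a ` endograph v)"
    by (rule bdd_belowI2[of _ 0]) (simp add: dbar_nonneg)
  ultimately show ?thesis
    using that endograph_nonempty[OF assms(1)] by (auto simp: cINF_less_iff)
qed

lemma H_end_nonneg:
  assumes "u \<in> F_USC" and "v \<in> F_USC"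
  shows "0 \<le> H_end u v"
proof -
  obtain a where a: "a \<in> endograph u" using endograph_nonempty[OF assms(1)] by blast
  have "0 \<le> (INF b\<in>endograph v. dbar a b)"
    using endograph_nonempty[OF assms(2)] by (intro cINF_greatest dbar_nonneg)
  also have "\<dots> \<le> H_end u v" using infdist_le_H_end[OF assms(2) a] .
  finally show ?thesis .
qed

lemma H_end_leI:
  assumes u: "u \<in> F_USC" and v: "v \<in> F_USC"
    and uv: "\<And>a. a \<in> endograph u \<Longrightarrow> \<exists>b\<in>endograph v. dbar a b \<le> e"
    and vu: "\<And>b. b \<in> endograph v \<Longrightarrow> \<exists>a\<in>endograph u. dbar a b \<le> e"
  shows "H_end u v \<le> e"
proof -
  have "(INF b\<in>endograph v. dbar a b) \<le> e" if "a \<in> endograph u" for a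
  proof -
    obtain b where "b \<in> endograph v" "dbar a b \<le> e" using uv \<open>a \<in> endograph u\<close> by blast
    then show ?thesis
      by (intro cINF_lower2 bdd_belowI2[of _ 0]) (auto simp: dbar_nonneg)
  qed
  moreover have "(INF a\<in>endograph u. dbar a b) \<le> e" if "b \<in> endograph v" for b
  proof -
    obtain a where "a \<in> endograph u" "dbar a b \<le> e" using vu \<open>b \<in> endograph v\<close> by blast
    then show ?thesis
      by (intro cINF_lower2 bdd_belowI2[of _ 0]) (auto simp: dbar_nonneg)
  qed
  ultimately show ?thesis
    unfolding H_end_def hausdorff_def
    using endograph_nonempty[OF u] endograph_nonempty[OF v] by (intro max.boundedI cSUP_least)
qed

section \<open>Uniform versus pointwise convergence\<close>

text \<open>Almost nearest points of \<open>endograph (u n)\<close> to a given point of \<open>endograph v\<close> converge to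
  that point. Conversely, a limit of points of \<open>endograph (u (r j))\<close> is also the limit of almost
  nearest points of \<open>endograph v\<close>, which is closed.\<close>

lemma Gamma_converges_if_H_end_tendsto_0:
  assumes u: "\<And>n. u n \<in> F_USC" and v: "v \<in> F_USC"
    and lim: "(\<lambda>n. H_end (u n) v) \<longlonglongrightarrow> 0"
  shows "Gamma_converges u v"
  unfolding Gamma_converges_iff
proof (intro conjI ballI allI impI)
  \<comment> \<open>the added null sequence makes the bound strict, so that a point within it exists\<close>
  define e where "e n = H_end (u n) v + inverse (real (Suc n))" for n
  have less: "H_end (u n) v < e n" for n by (simp add: e_def)
  have e0: "e \<longlonglongrightarrow> 0"
    unfolding e_def using tendsto_add[OF lim LIMSEQ_inverse_real_of_nat] by simp
  {
    fix z assume z: "z \<in> endograph v"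
    have "\<exists>a\<in>endograph (u n). dbar z a < e n" for n
    proof -
      have "H_end v (u n) < e n" using less by (simp add: H_end_commute)
      from close_point_if_H_end_less[OF u this z] show ?thesis by blast
    qed
    then obtain s where s: "\<And>n. s n \<in> endograph (u n)" "\<And>n. dbar z (s n) < e n" by metis
    have "dist (s n) z \<le> e n" for n
      using s(2)[of n] dist_le_dbar[of z "s n"] by (simp add: dist_commute)
    then have "(\<lambda>n. dist (s n) z) \<longlonglongrightarrow> 0"
      by (intro tendsto_sandwich[OF _ _ tendsto_const e0]) auto
    then have "s \<longlonglongrightarrow> z" by (simp add: tendsto_dist_iff[of s])
    with s(1) show "\<exists>s. (\<forall>n. s n \<in> endograph (u n)) \<and> s \<longlonglongrightarrow> z" by blast
  next
    fix r :: "nat \<Rightarrow> nat" and s z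
    assume r: "strict_mono r" and s: "\<forall>j. s j \<in> endograph (u (r j))" and sz: "s \<longlonglongrightarrow> z"
    have "\<exists>b\<in>endograph v. dbar (s j) b < e (r j)" for j
      using close_point_if_H_end_less[OF v less s[rule_format], of j] by blast
    then obtain b where b: "\<And>j. b j \<in> endograph v" "\<And>j. dbar (s j) (b j) < e (r j)" by metis
    have er: "(\<lambda>j. e (r j)) \<longlonglongrightarrow> 0"
      using LIMSEQ_subseq_LIMSEQ[OF e0 r] by (simp add: o_def)
    have lim': "(\<lambda>j. e (r j) + dist (s j) z) \<longlonglongrightarrow> 0"
      using tendsto_add[OF er tendsto_dist_iff[THEN iffD1, OF sz]] by simp
    have "dist (b j) z \<le> e (r j) + dist (s j) z" for j
      using b(2)[of j] dist_le_dbar[of "s j" "b j"] dist_triangle3[of "b j" z "s j"] by simp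
    then have "(\<lambda>j. dist (b j) z) \<longlonglongrightarrow> 0"
      by (intro tendsto_sandwich[OF _ _ tendsto_const lim']) auto
    then have "b \<longlonglongrightarrow> z" by (simp add: tendsto_dist_iff[of b])
    with closed_endograph[OF v] b(1) show "z \<in> endograph v" by (rule closed_sequentially)
  }
qed

lemma subseq_of_counterexamples:
  assumes "\<not> (\<forall>\<^sub>F n in sequentially. \<forall>x\<in>A n. P n x)"
  shows "\<exists>r x. strict_mono (r :: nat \<Rightarrow> nat) \<and> (\<forall>j. x j \<in> A (r j) \<and> \<not> P (r j) (x j))"
proof -
  have "infinite {n. \<not> (\<forall>x\<in>A n. P n x)}"
    using assms unfolding cofinite_eq_sequentially[symmetric] eventually_cofinite .
  from infinite_enumerate[OF this] obtain r :: "nat \<Rightarrow> nat"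
    where r: "strict_mono r" and bad: "\<forall>j. r j \<in> {n. \<not> (\<forall>x\<in>A n. P n x)}"
    by blast
  from bad have "\<forall>j. \<exists>x. x \<in> A (r j) \<and> \<not> P (r j) x" by blast
  from choice[OF this] r show ?thesis by blast
qed

text \<open>Each of the two directions of uniform closeness is proved by contradiction: the points
  witnessing its failure have a convergent subsequence, whose limit \<open>l\<close> lies in \<open>endograph v\<close>.
  Points of \<open>endograph (u n)\<close> that stay away from \<open>endograph v\<close> contradict this at once; points of
  \<open>endograph v\<close> that stay away from \<open>endograph (u n)\<close> do so because \<open>l\<close> is a limit of points of
  the latter sets.\<close>

lemma H_end_tendsto_0_if_Gamma_converges:
  fixes u :: "nat \<Rightarrow> 'a::metric_space \<Rightarrow> real"
  assumes compact: "compact (UNIV :: 'a set)"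
    and u: "\<And>n. u n \<in> F_USC" and v: "v \<in> F_USC" and G: "Gamma_converges u v"
  shows "(\<lambda>n. H_end (u n) v) \<longlonglongrightarrow> 0"
proof (rule tendstoI)
  fix e :: real assume e: "e > 0"
  have "compact (UNIV \<times> {0..1} :: ('a \<times> real) set)"
    using compact by (intro compact_Times) auto
  then have subseq: "\<exists>q l. strict_mono (q :: nat \<Rightarrow> nat) \<and> (a \<circ> q) \<longlonglongrightarrow> l"
    if "\<And>j. a j \<in> UNIV \<times> {0..1}" for a :: "nat \<Rightarrow> 'a \<times> real"
    using that unfolding compact_eq_seq_compact_metric seq_compact_def by blast
  note lower = Gamma_converges_iff[THEN iffD1, OF G, THEN conjunct1, rule_format]
  note upper = Gamma_converges_iff[THEN iffD1, OF G, THEN conjunct2, rule_format]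
  have meet: "\<exists>j. dbar (f j) (g j) \<le> e / 2" if "f \<longlonglongrightarrow> l" "g \<longlonglongrightarrow> l"
    for f g :: "nat \<Rightarrow> 'a \<times> real" and l
  proof -
    have "\<forall>\<^sub>F j in sequentially. dist (f j) (g j) < e / 4"
      using tendsto_dist[OF that] e by (intro order_tendstoD) auto
    then obtain j where "dist (f j) (g j) < e / 4"
      using eventually_happens by force
    then show ?thesis
      using dbar_le_dist[of "f j" "g j"] by (intro exI[of _ j]) simp
  qed
  have uv: "\<forall>\<^sub>F n in sequentially. \<forall>a\<in>endograph (u n). \<exists>b\<in>endograph v. dbar a b \<le> e / 2"
  proof (rule ccontr)
    assume *: "\<not> ?thesis"
    from subseq_of_counterexamples[OF *] obtain r :: "nat \<Rightarrow> nat" and a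
      where r: "strict_mono r"
      and "\<forall>j. a j \<in> endograph (u (r j)) \<and> \<not> (\<exists>b\<in>endograph v. dbar (a j) b \<le> e / 2)"
      by blast
    then have a: "\<And>j. a j \<in> endograph (u (r j))"
      and far: "\<And>j b. b \<in> endograph v \<Longrightarrow> \<not> dbar (a j) b \<le> e / 2"
      by blast+
    obtain q l where q: "strict_mono q" "(a \<circ> q) \<longlonglongrightarrow> l"
      using subseq[of a] a endograph_subset by blast
    have "l \<in> endograph v"
      using upper[OF strict_mono_o[OF r q(1)] _ q(2)] a by simp
    with meet[OF q(2) tendsto_const] far show False by auto
  qed
  have vu: "\<forall>\<^sub>F n in sequentially. \<forall>b\<in>endograph v. \<exists>a\<in>endograph (u n). dbar a b \<le> e / 2"
  proof (rule ccontr)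
    assume *: "\<not> ?thesis"
    from subseq_of_counterexamples[OF *] obtain r :: "nat \<Rightarrow> nat" and b
      where r: "strict_mono r"
      and "\<forall>j. b j \<in> endograph v \<and> \<not> (\<exists>a\<in>endograph (u (r j)). dbar a (b j) \<le> e / 2)"
      by blast
    then have b: "\<And>j. b j \<in> endograph v"
      and far: "\<And>j a. a \<in> endograph (u (r j)) \<Longrightarrow> \<not> dbar a (b j) \<le> e / 2"
      by blast+
    obtain q l where q: "strict_mono q" "(b \<circ> q) \<longlonglongrightarrow> l"
      using subseq[of b] b endograph_subset by blast
    have "l \<in> endograph v"
      using closed_sequentially[OF closed_endograph[OF v] _ q(2)] b by simp
    then obtain s where s: "\<And>n. s n \<in> endograph (u n)" "s \<longlonglongrightarrow> l" using lower by blast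
    have "(s \<circ> (r \<circ> q)) \<longlonglongrightarrow> l"
      using LIMSEQ_subseq_LIMSEQ[OF s(2) strict_mono_o[OF r q(1)]] .
    from meet[OF this q(2)] far s(1) show False by auto
  qed
  from uv vu show "\<forall>\<^sub>F n in sequentially. dist (H_end (u n) v) 0 < e"
  proof eventually_elim
    case (elim n)
    then have "H_end (u n) v \<le> e / 2" by (intro H_end_leI u v) auto
    then show ?case using e H_end_nonneg[OF u v, of n] by simp
  qed
qed

section \<open>Escaping spikes\<close>

lemma F_USCG_subset_F_USC: "F_USCG \<subseteq> F_USC"
  by (auto simp: F_USCG_def)

lemma F_USCB_subset_F_USCG: "F_USCB \<subseteq> F_USCG"
proof
  fix u :: "'a::metric_space \<Rightarrow> real" assume u: "u \<in> F_USCB"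
  have "compact (cut u \<alpha>)" if \<alpha>: "\<alpha> \<in> {0<..1}" for \<alpha>
  proof -
    have "cut u \<alpha> \<subseteq> cut u 0"
      using \<alpha> closure_subset[of "{x. u x > 0}"] by (force simp: cut_def)
    moreover have "closed (cut u \<alpha>)" using u \<alpha> by (auto simp: F_USCB_def F_USC_def)
    moreover have "compact (cut u 0)" using u by (simp add: F_USCB_def)
    ultimately show ?thesis by (metis compact_Int_closed inf.absorb2)
  qed
  then show "u \<in> F_USCG" using u by (auto simp: F_USCB_def F_USCG_def)
qed

lemma indicator_finite_in_F_USCB:
  fixes A :: "'a::metric_space set"
  assumes A: "finite A"
  shows "indicat_real A \<in> F_USCB"
proof -
  have "{x. indicat_real A x > 0} = A"
    by (auto simp: indicator_def)
  then have 0: "cut (indicat_real A) 0 = A"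
    using A by (simp add: cut_def finite_imp_closed)
  have "cut (indicat_real A) \<alpha> = A" if "\<alpha> \<in> {0..1}" for \<alpha>
  proof (cases "\<alpha> = 0")
    case False
    then show ?thesis using that by (auto simp: cut_def indicator_def)
  qed (use 0 in simp)
  then show ?thesis
    using A 0 by (auto simp: F_USCB_def F_USC_def finite_imp_closed finite_imp_compact
        indicator_def)
qed

lemma zero_in_F_USCB: "(\<lambda>_. 0) \<in> F_USCB"
proof -
  have "(\<lambda>_. 0) = indicat_real ({} :: 'a set)" by (simp add: fun_eq_iff)
  then show ?thesis using indicator_finite_in_F_USCB[of "{} :: 'a set"] by simp
qed

lemma H_end_indicator_zero_ge_1:
  "1 \<le> H_end (indicat_real {x}) (\<lambda>_. 0)"
proof -
  have zero: "(\<lambda>_. 0) \<in> F_USC"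
    using zero_in_F_USCB F_USCB_subset_F_USCG F_USCG_subset_F_USC by blast
  have tip: "(x, 1) \<in> endograph (indicat_real {x})"
    by (simp add: endograph_def)
  have "1 \<le> (INF b\<in>endograph (\<lambda>_. 0). dbar (x, 1) b)"
    using endograph_nonempty[OF zero] by (intro cINF_greatest) (auto simp: endograph_def dbar_def)
  also have "\<dots> \<le> H_end (indicat_real {x}) (\<lambda>_. 0)" using infdist_le_H_end[OF zero tip] .
  finally show ?thesis .
qed

lemma Gamma_converges_escaping_spikes:
  fixes x :: "nat \<Rightarrow> 'a::metric_space"
  assumes escape: "\<And>r l. strict_mono (r :: nat \<Rightarrow> nat) \<Longrightarrow> \<not> (x \<circ> r) \<longlonglongrightarrow> l"
  shows "Gamma_converges (\<lambda>n. indicat_real {x n}) (\<lambda>_. 0)"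
  unfolding Gamma_converges_iff
proof (intro conjI ballI allI impI)
  fix z :: "'a \<times> real" assume z: "z \<in> endograph (\<lambda>_. 0)"
  then show "\<exists>s. (\<forall>n. s n \<in> endograph (indicat_real {x n})) \<and> s \<longlonglongrightarrow> z"
    by (intro exI[of _ "\<lambda>_. z"]) (auto simp: endograph_def indicator_def)
next
  fix r :: "nat \<Rightarrow> nat" and s :: "nat \<Rightarrow> 'a \<times> real" and z
  assume r: "strict_mono r" and s: "\<forall>j. s j \<in> endograph (indicat_real {x (r j)})"
    and lim: "s \<longlonglongrightarrow> z"
  have fst: "(\<lambda>j. fst (s j)) \<longlonglongrightarrow> fst z" and snd: "(\<lambda>j. snd (s j)) \<longlonglongrightarrow> snd z"
    using lim by (auto intro: tendsto_fst tendsto_snd)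
  have "0 \<le> snd (s j)" for j
    using s[rule_format, of j] by (auto simp: endograph_def)
  then have "0 \<le> snd z" using LIMSEQ_le_const[OF snd] by blast
  moreover have "\<not> 0 < snd z"
  proof
    assume "0 < snd z"
    \<comment> \<open>at positive height the points lie on the spikes, whose feet would then converge\<close>
    with snd have "\<forall>\<^sub>F j in sequentially. 0 < snd (s j)" by (rule order_tendstoD)
    then have "\<forall>\<^sub>F j in sequentially. fst (s j) = (x \<circ> r) j"
    proof eventually_elim
      case (elim j)
      then show ?case
        using s[rule_format, of j]
        by (cases "fst (s j) = x (r j)") (auto simp: endograph_def indicator_def)
    qed
    with fst have "(x \<circ> r) \<longlonglongrightarrow> fst z"
      using tendsto_cong by fastforce
    with escape[OF r] show False by blast
  qed
  ultimately show "z \<in> endograph (\<lambda>_. 0)" by (cases z) (auto simp: endograph_def)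
qed

lemma compact_if_Gamma_converges_imp_H_end_tendsto_0:
  assumes imp: "\<And>(u :: nat \<Rightarrow> 'a::metric_space \<Rightarrow> real) v. (\<And>n. u n \<in> F_USCB) \<Longrightarrow> v \<in> F_USCB \<Longrightarrow>
      Gamma_converges u v \<Longrightarrow> (\<lambda>n. H_end (u n) v) \<longlonglongrightarrow> 0"
  shows "compact (UNIV :: 'a set)"
proof (rule ccontr)
  assume "\<not> ?thesis"
  then obtain x :: "nat \<Rightarrow> 'a" where "\<And>r l. strict_mono (r :: nat \<Rightarrow> nat) \<Longrightarrow> \<not> (x \<circ> r) \<longlonglongrightarrow> l"
    unfolding compact_eq_seq_compact_metric seq_compact_def by blast
  then have "Gamma_converges (\<lambda>n. indicat_real {x n}) (\<lambda>_. 0)"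
    by (rule Gamma_converges_escaping_spikes)
  then have "(\<lambda>n. H_end (indicat_real {x n}) (\<lambda>_. 0)) \<longlonglongrightarrow> 0"
    by (intro imp indicator_finite_in_F_USCB zero_in_F_USCB) auto
  then have "(1::real) \<le> 0"
    by (rule LIMSEQ_le_const) (blast intro: H_end_indicator_zero_ge_1)
  then show False by simp
qed

text \<open>Compactness yields the equivalence for all of \<open>F_USC\<close>, hence for every subclass, while the
  escaping spikes already live in \<open>F_USCB\<close>. Every class in between therefore characterises
  compactness.\<close>

lemma compact_iff_H_end_tendsto_0_iff_Gamma_converges:
  fixes F :: "('a::metric_space \<Rightarrow> real) set"
  assumes "F_USCB \<subseteq> F" and "F \<subseteq> F_USC"
  shows "compact (UNIV :: 'a set) \<longleftrightarrow>
           (\<forall>(u :: nat \<Rightarrow> 'a \<Rightarrow> real) v. (\<forall>n. u n \<in> F) \<and> v \<in> F \<longrightarrow>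
              ((\<lambda>n. H_end (u n) v) \<longlonglongrightarrow> 0 \<longleftrightarrow> Gamma_converges u v))" (is "_ \<longleftrightarrow> ?equiv")
proof
  assume compact: "compact (UNIV :: 'a set)"
  show ?equiv
  proof (intro allI impI, elim conjE)
    fix u :: "nat \<Rightarrow> 'a \<Rightarrow> real" and v assume "\<forall>n. u n \<in> F" "v \<in> F"
    then have "\<And>n. u n \<in> F_USC" "v \<in> F_USC" using assms(2) by auto
    then show "(\<lambda>n. H_end (u n) v) \<longlonglongrightarrow> 0 \<longleftrightarrow> Gamma_converges u v"
      using Gamma_converges_if_H_end_tendsto_0 H_end_tendsto_0_if_Gamma_converges[OF compact]
      by blast
  qed
next
  assume equiv: ?equiv
  show "compact (UNIV :: 'a set)"
  proof (rule compact_if_Gamma_converges_imp_H_end_tendsto_0)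
    fix u :: "nat \<Rightarrow> 'a \<Rightarrow> real" and v
    assume "\<And>n. u n \<in> F_USCB" "v \<in> F_USCB" "Gamma_converges u v"
    then show "(\<lambda>n. H_end (u n) v) \<longlonglongrightarrow> 0"
      using equiv[rule_format, of u v] assms(1) by (simp add: subset_iff)
  qed
qed

theorem proposition7p3:
  shows "(compact (UNIV :: 'a::metric_space set) \<longleftrightarrow>
            (\<forall>(u :: nat \<Rightarrow> 'a \<Rightarrow> real) v. (\<forall>n. u n \<in> F_USC) \<and> v \<in> F_USC \<longrightarrow>
               ((\<lambda>n. H_end (u n) v) \<longlonglongrightarrow> 0 \<longleftrightarrow> Gamma_converges u v)))
       \<and> (compact (UNIV :: 'a::metric_space set) \<longleftrightarrow>
            (\<forall>(u :: nat \<Rightarrow> 'a \<Rightarrow> real) v. (\<forall>n. u n \<in> F_USCG) \<and> v \<in> F_USCG \<longrightarrow>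
               ((\<lambda>n. H_end (u n) v) \<longlonglongrightarrow> 0 \<longleftrightarrow> Gamma_converges u v)))
       \<and> (compact (UNIV :: 'a::metric_space set) \<longleftrightarrow>
            (\<forall>(u :: nat \<Rightarrow> 'a \<Rightarrow> real) v. (\<forall>n. u n \<in> F_USCB) \<and> v \<in> F_USCB \<longrightarrow>
               ((\<lambda>n. H_end (u n) v) \<longlonglongrightarrow> 0 \<longleftrightarrow> Gamma_converges u v)))"
  by (intro conjI compact_iff_H_end_tendsto_0_iff_Gamma_converges order_refl F_USCG_subset_F_USC
      F_USCB_subset_F_USCG order_trans[OF F_USCB_subset_F_USCG F_USCG_subset_F_USC])

end
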